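(* For every constant $\varepsilon$ with $0<\varepsilon<1$, there is no deterministic online exploration algorithm that is $(2-\varepsilon)$-competitive on tadpole graphs with unit edge weights; that is, for every such algorithm $A$ there exist a unit-weight tadpole graph $G$ and a starting vertex $s$ such that $\mathrm{cost}_A(G,s) > (2-\varepsilon)\cdot \mathrm{cost}_{\mathrm{opt}}(G,s)$, even when the searcher is promised that the input graph is a tadpole graph.
   Context: A tadpole graph $T_{i,j}$ ($i\ge 3$, $j\ge 1$) is a connected undirected graph consisting of a cycle on $i$ vertices together with a path (the stem) of $j$ further vertices, one endpoint of which is joined by an edge to one vertex of the cycle (the junction); equivalently, exactly one vertex has degree 1, exactly one has degree 3, and all others have degree 2. Every edge $e$ carries a positive weight $c(e)$; here all weights equal 1. Online exploration model: vertices have unique identifiers; a searcher starts at a vertex $s$, initially knowing only $s$; whenever it arrives at a vertex $v$ it learns the identifiers of all neighbours of $v$ and the weights of all edges incident to $v$. Moving along an edge costs its weight (each time it is traversed). The searcher (with unlimited computation and memory) must perform a closed walk from $s$ visiting all vertices and returning to $s$. $\mathrm{cost}_A(G,s)$ is the total cost of the walk produced by algorithm $A$, and $\mathrm{cost}_{\mathrm{opt}}(G,s)$ is the minimum cost of a closed walk from $s$ visiting all vertices of $G$. An algorithm is $c$-competitive on a graph class if $\mathrm{cost}_A(G,s)\le c\cdot\mathrm{cost}_{\mathrm{opt}}(G,s)$ for all graphs $G$ in the class and all start vertices $s$. *)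

theory Defs
  imports Complex_Main
begin

record wgraph =
  verts :: "nat set"
  edges :: "nat set set"
  weight :: "nat set \<Rightarrow> real"

definition weighted_graph :: "wgraph \<Rightarrow> bool" where
  "weighted_graph G \<longleftrightarrow>
     finite (verts G) \<and>
     (\<forall>e\<in>edges G. e \<subseteq> verts G \<and> card e = 2 \<and> weight G e > 0)"

text \<open>The cycle is listed starting from the junction, the stem starting from its vertex
  adjacent to the junction.\<close>

definition is_tadpole :: "nat \<Rightarrow> nat \<Rightarrow> wgraph \<Rightarrow> bool" where
  "is_tadpole i j G \<longleftrightarrow>
     weighted_graph G \<and> i \<ge> 3 \<and> j \<ge> 1 \<and>
     (\<exists>cyc stem. length cyc = i \<and> length stem = j \<and> distinct (cyc @ stem) \<and>
        verts G = set (cyc @ stem) \<and>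
        edges G = {{cyc ! k, cyc ! (Suc k mod i)} | k. k < i}
                  \<union> {{cyc ! 0, stem ! 0}}
                  \<union> {{stem ! k, stem ! Suc k} | k. Suc k < j})"

definition unit_tadpoles :: "wgraph set" where
  "unit_tadpoles = {G. (\<exists>i j. is_tadpole i j G) \<and> (\<forall>e\<in>edges G. weight G e = 1)}"

text \<open>A walk is given by the nonempty list of its vertices.\<close>

definition walk :: "wgraph \<Rightarrow> nat list \<Rightarrow> bool" where
  "walk G xs \<longleftrightarrow> xs \<noteq> [] \<and> set xs \<subseteq> verts G \<and>
     (\<forall>k. Suc k < length xs \<longrightarrow> {xs ! k, xs ! Suc k} \<in> edges G)"

definition walk_cost :: "wgraph \<Rightarrow> nat list \<Rightarrow> real" where
  "walk_cost G xs = (\<Sum>k<length xs - 1. weight G {xs ! k, xs ! Suc k})"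

definition exploration_tour :: "wgraph \<Rightarrow> nat \<Rightarrow> nat list \<Rightarrow> bool" where
  "exploration_tour G s xs \<longleftrightarrow> walk G xs \<and> hd xs = s \<and> last xs = s \<and> set xs = verts G"

definition cost_opt :: "wgraph \<Rightarrow> nat \<Rightarrow> real" where
  "cost_opt G s = Inf (walk_cost G ` {xs. exploration_tour G s xs})"

text \<open>What the searcher learns on arriving at a vertex: its identifier, the identifiers of its
  neighbours and the weights of the corresponding edges.\<close>

type_synonym observation = "nat \<times> (nat \<times> real) set"

definition observe :: "wgraph \<Rightarrow> nat \<Rightarrow> observation" where
  "observe G v = (v, {(w, weight G {v, w}) | w. {v, w} \<in> edges G})"

text \<open>A deterministic online algorithm maps the sequence of all observations made so far (oldest
  first) to the next vertex to move to, or to \<^const>\<open>None\<close> if it stops. Since its own earlier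
  decisions are determined by the history, this captures unlimited memory.\<close>

type_synonym algorithm = "observation list \<Rightarrow> nat option"

definition produces :: "algorithm \<Rightarrow> wgraph \<Rightarrow> nat \<Rightarrow> nat list \<Rightarrow> bool" where
  "produces A G s xs \<longleftrightarrow> xs \<noteq> [] \<and> hd xs = s \<and>
     (\<forall>k. Suc k < length xs \<longrightarrow> A (map (observe G) (take (Suc k) xs)) = Some (xs ! Suc k)) \<and>
     A (map (observe G) xs) = None"

definition cost_alg :: "algorithm \<Rightarrow> wgraph \<Rightarrow> nat \<Rightarrow> real" where
  "cost_alg A G s = walk_cost G (THE xs. produces A G s xs)"

text \<open>Correctness is only required on the given class: this is the promise that the input
  belongs to the class.\<close>

definition explores :: "algorithm \<Rightarrow> wgraph set \<Rightarrow> bool" where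
  "explores A \<C> \<longleftrightarrow>
     (\<forall>G\<in>\<C>. \<forall>s\<in>verts G. \<exists>xs. produces A G s xs \<and> exploration_tour G s xs)"

definition competitive :: "real \<Rightarrow> algorithm \<Rightarrow> wgraph set \<Rightarrow> bool" where
  "competitive c A \<C> \<longleftrightarrow> (\<forall>G\<in>\<C>. \<forall>s\<in>verts G. cost_alg A G s \<le> c * cost_opt G s)"

lemma produces_take:
  assumes "produces A G s xs" "produces A G s ys" "k < length xs"
  shows "k < length ys \<and> take (Suc k) xs = take (Suc k) ys"
  using assms(3)
proof (induction k)
  case 0
  then show ?case using assms(1,2)
    by (cases xs; cases ys) (auto simp: produces_def)
next
  case (Suc k)
  then have IH: "k < length ys" "take (Suc k) xs = take (Suc k) ys" by auto
  have A: "A (map (observe G) (take (Suc k) ys)) = Some (xs ! Suc k)"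
    using assms(1) Suc.prems IH(2) by (metis produces_def)
  have len: "Suc k < length ys"
  proof (rule ccontr)
    assume "\<not> Suc k < length ys"
    then have "take (Suc k) ys = ys" by simp
    then show False using A assms(2) by (simp add: produces_def)
  qed
  then have "ys ! Suc k = xs ! Suc k"
    using A assms(2) by (simp add: produces_def)
  then show ?case using len IH Suc.prems by (simp add: take_Suc_conv_app_nth)
qed

lemma produces_unique:
  assumes "produces A G s xs" "produces A G s ys"
  shows "xs = ys"
proof -
  have ne: "xs \<noteq> []" "ys \<noteq> []" using assms by (auto simp: produces_def)
  have "length ys - 1 < length xs"
    using produces_take[OF assms(2,1), of "length ys - 1"] ne by simp
  moreover have "length xs - 1 < length ys \<and>
      take (Suc (length xs - 1)) xs = take (Suc (length xs - 1)) ys"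
    using produces_take[OF assms, of "length xs - 1"] ne by simp
  ultimately show ?thesis using ne by simp
qed

lemma cost_alg_eq: "produces A G s xs \<Longrightarrow> cost_alg A G s = walk_cost G xs"
  unfolding cost_alg_def by (metis produces_unique the_equality)

lemma cost_opt_attained:
  assumes G: "weighted_graph G" and t0: "exploration_tour G s xs0"
  shows "\<exists>xs. exploration_tour G s xs \<and> walk_cost G xs = cost_opt G s \<and>
           (\<forall>ys. exploration_tour G s ys \<longrightarrow> walk_cost G xs \<le> walk_cost G ys)"
proof -
  have finV: "finite (verts G)" using G by (simp add: weighted_graph_def)
  have finE: "finite (edges G)"
    by (rule finite_subset[of _ "Pow (verts G)"]) (use G finV in \<open>auto simp: weighted_graph_def\<close>)
  define m where "m = Min (insert 1 (weight G ` edges G))"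
  have m: "m > 0" "\<And>e. e \<in> edges G \<Longrightarrow> m \<le> weight G e"
    using finE G by (auto simp: m_def weighted_graph_def)
  have lb: "m * real (length ys - 1) \<le> walk_cost G ys" if "exploration_tour G s ys" for ys
  proof -
    have "(\<Sum>k<length ys - 1. m) \<le> walk_cost G ys"
      unfolding walk_cost_def
      by (rule sum_mono) (use that in \<open>auto intro!: m simp: exploration_tour_def walk_def\<close>)
    then show ?thesis by (simp add: mult.commute)
  qed
  define N where "N = nat \<lceil>walk_cost G xs0 / m\<rceil> + 1"
  define T where "T = {ys. exploration_tour G s ys \<and> walk_cost G ys \<le> walk_cost G xs0}"
  have "T \<subseteq> {ys. set ys \<subseteq> verts G \<and> length ys \<le> N}"
  proof
    fix ys assume "ys \<in> T"
    then have ys: "exploration_tour G s ys" "walk_cost G ys \<le> walk_cost G xs0"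
      by (auto simp: T_def)
    have "real (length ys - 1) \<le> walk_cost G xs0 / m"
      using lb[OF ys(1)] ys(2) m(1) by (simp add: field_simps)
    then have "length ys - 1 \<le> nat \<lceil>walk_cost G xs0 / m\<rceil>" by linarith
    then show "ys \<in> {ys. set ys \<subseteq> verts G \<and> length ys \<le> N}"
      using ys(1) by (auto simp: N_def exploration_tour_def)
  qed
  then have finT: "finite T"
    using finite_lists_length_le[OF finV] finite_subset by blast
  have "xs0 \<in> T" using t0 by (simp add: T_def)
  then obtain xs where xs: "xs \<in> T" "\<And>ys. ys \<in> T \<Longrightarrow> walk_cost G xs \<le> walk_cost G ys"
    using finT by (metis arg_min_least arg_min_if_finite(1) empty_iff)
  have le: "walk_cost G xs \<le> walk_cost G ys" if "exploration_tour G s ys" for ys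
    using that xs by (cases "walk_cost G ys \<le> walk_cost G xs0") (auto simp: T_def)
  have "walk_cost G xs = cost_opt G s"
    unfolding cost_opt_def using xs(1) le
    by (intro cInf_eq_minimum[symmetric]) (auto simp: T_def)
  then show ?thesis using xs(1) le by (auto simp: T_def)
qed

end

theory Submission imports Defs begin

text \<open>The adversary starts the searcher in the middle of a path of degree-2 vertices and puts the
  junction at the first vertex at distance \<open>N\<close> from the start that the searcher reaches. Suppose
  that it has gone \<open>x\<close> beyond the start in the other direction by then, so that it has paid at
  least \<open>N + 2x\<close>. Two unknown arms leave the junction; they are extended until the searcher either
  gets to depth \<open>N + x\<close> in one of them, having explored the other one to depth \<open>p\<close>, or returns and
  goes further than \<open>x\<close> beyond the start. In the first case the deep arm closes the cycle, of length
  about \<open>2(N + x)\<close>, exactly opposite to the junction, and the other arm is the stem, ending just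
  beyond what was explored: the searcher has paid \<open>2N + 3x + 2p\<close>, and visiting the end of the stem
  and returning costs \<open>2N + x + 2p\<close> more, in total twice the optimum \<open>2(N + x) + 2p\<close>. In the second
  case, with arms explored to depths \<open>p\<close> and \<open>q\<close>, it has paid \<open>2N + 3x + 2p + 2q\<close>; the arm of depth
  \<open>q\<close> closes the cycle and the other one is the stem, which costs \<open>2p\<close> more, against the optimum
  \<open>N + x + q + 2p\<close>. Up to additive constants the ratio is thus at least 2, and \<open>N\<close> is arbitrary.\<close>

section \<open>Determinism and step counting along walks\<close>

text \<open>Each move depends only on the observations made so far. Agreement is required only for
  \<open>m < k\<close>: the vertex reached at time \<open>k\<close> is not yet observed, so the
  adversary may still decide its surroundings.\<close>

lemma produces_prefix:
  assumes "produces A G s xs" "produces A H s ys" "k < length xs"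
    and "\<And>m. m < k \<Longrightarrow> observe G (xs ! m) = observe H (xs ! m)"
  shows "k < length ys \<and> take (Suc k) ys = take (Suc k) xs"
  using assms(3,4)
proof (induction k)
  case 0
  then show ?case using assms(1,2)
    by (cases xs; cases ys) (auto simp: produces_def)
next
  case (Suc k)
  then have IH: "k < length ys" "take (Suc k) ys = take (Suc k) xs" by auto
  have "map (observe H) (take (Suc k) xs) = map (observe G) (take (Suc k) xs)"
    using Suc.prems by (auto simp: list_eq_iff_nth_eq)
  then have A: "A (map (observe H) (take (Suc k) ys)) = Some (xs ! Suc k)"
    using assms(1) Suc.prems(1) IH(2) by (metis produces_def)
  have len: "Suc k < length ys"
  proof (rule ccontr)
    assume "\<not> Suc k < length ys"
    then have "take (Suc k) ys = ys" by simp
    then show False using A assms(2) by (simp add: produces_def)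
  qed
  then have "ys ! Suc k = xs ! Suc k"
    using A assms(2) by (simp add: produces_def)
  then show ?case using len IH Suc.prems by (simp add: take_Suc_conv_app_nth)
qed

text \<open>All lower bounds on elapsed time come from this: a potential that changes by at most 1
  per step needs as many steps as its total change.\<close>

lemma diff_le_steps:
  fixes f :: "nat \<Rightarrow> int"
  assumes "m \<le> n" "\<And>k. m \<le> k \<Longrightarrow> k < n \<Longrightarrow> \<bar>f (Suc k) - f k\<bar> \<le> 1"
  shows "f n - f m \<le> int n - int m" "f m - f n \<le> int n - int m"
proof -
  have "\<bar>f n - f m\<bar> \<le> int n - int m" using assms
  proof (induction n rule: dec_induct)
    case (step n)
    have "\<bar>f n - f m\<bar> \<le> int n - int m" "\<bar>f (Suc n) - f n\<bar> \<le> 1"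
      using step by auto
    then show ?case by linarith
  qed simp
  then show "f n - f m \<le> int n - int m" "f m - f n \<le> int n - int m" by linarith+
qed

text \<open>\<open>W\<close> is the set of exits of \<open>S\<close>: a walk cannot leave
  \<open>S\<close> without stepping into \<open>W\<close>.\<close>

lemma stays_in_region:
  assumes "walk G xs" "hd xs \<in> S"
    and "\<And>u v. u \<in> S \<Longrightarrow> {u, v} \<in> edges G \<Longrightarrow> v \<in> S \<union> W"
    and "n \<le> length xs" "\<And>k. k < n \<Longrightarrow> xs ! k \<notin> W" "k < n"
  shows "xs ! k \<in> S"
  using assms(6)
proof (induction k)
  case 0
  then show ?case using assms(1,2) by (simp add: walk_def hd_conv_nth)
next
  case (Suc k)
  then have "{xs ! k, xs ! Suc k} \<in> edges G"
    using assms(1,4) by (simp add: walk_def)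
  then show ?case using Suc assms(3,5) by fastforce
qed

section \<open>The infinite star and the tadpoles cut from it\<close>

text \<open>Three infinite arms glued at the junction \<open>a 0\<close>, with start vertex \<open>a N\<close>: this is what the
  searcher sees. That depth functions exist makes the labellings injective and the arms disjoint.\<close>

locale star =
  fixes a b c \<alpha> \<beta> \<gamma> :: "nat \<Rightarrow> nat"
  assumes centre: "b 0 = a 0" "c 0 = a 0"
    and depth [simp]: "\<alpha> (a k) = k" "\<alpha> (b k) = 0" "\<alpha> (c k) = 0"
      "\<beta> (a k) = 0" "\<beta> (b k) = k" "\<beta> (c k) = 0"
      "\<gamma> (a k) = 0" "\<gamma> (b k) = 0" "\<gamma> (c k) = k"
begin

lemma swap: "star a c b \<alpha> \<gamma> \<beta>"
  by unfold_locales (simp_all add: centre)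

definition star_edges :: "nat set set" where
  "star_edges = {{a k, a (Suc k)} | k. True} \<union> {{b k, b (Suc k)} | k. True}
     \<union> {{c k, c (Suc k)} | k. True}"

text \<open>The closing edge turns the arms \<open>a\<close> and \<open>b\<close> into the cycle, of
  length \<open>A + B + 1\<close>; the arm \<open>c\<close> is the stem.\<close>

definition tadpole :: "nat \<Rightarrow> nat \<Rightarrow> nat \<Rightarrow> wgraph" where
  "tadpole A B C = \<lparr>verts = a ` {..A} \<union> b ` {..B} \<union> c ` {..C},
     edges = {{a k, a (Suc k)} | k. k < A} \<union> {{b k, b (Suc k)} | k. k < B}
       \<union> {{c k, c (Suc k)} | k. k < C} \<union> {{a A, b B}},
     weight = \<lambda>_. 1\<rparr>"

lemma a_eq [simp]: "a k = a m \<longleftrightarrow> k = m" by (metis depth(1))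
lemma b_eq [simp]: "b k = b m \<longleftrightarrow> k = m" by (metis depth(5))
lemma c_eq [simp]: "c k = c m \<longleftrightarrow> k = m" by (metis depth(9))
lemma a_b_eq: "a k = b m \<longleftrightarrow> k = 0 \<and> m = 0" "b m = a k \<longleftrightarrow> k = 0 \<and> m = 0"
  by (metis centre depth)+
lemma a_c_eq: "a k = c m \<longleftrightarrow> k = 0 \<and> m = 0" by (metis centre depth)
lemma b_c_eq: "b k = c m \<longleftrightarrow> k = 0 \<and> m = 0" by (metis centre depth)

lemma star_edge_cases:
  assumes "{u, v} \<in> star_edges"
  obtains k where "u = a k" "v = a (Suc k)" | k where "u = a (Suc k)" "v = a k"
    | k where "u = b k" "v = b (Suc k)" | k where "u = b (Suc k)" "v = b k"
    | k where "u = c k" "v = c (Suc k)" | k where "u = c (Suc k)" "v = c k"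
proof -
  consider k where "{u, v} = {a k, a (Suc k)}" | k where "{u, v} = {b k, b (Suc k)}"
    | k where "{u, v} = {c k, c (Suc k)}"
    using assms unfolding star_edges_def by blast
  then show thesis by cases (metis doubleton_eq_iff that)+
qed

text \<open>Along an edge only one depth changes, by 1. A difference of two depths is a signed
  position on the path formed by two arms, so it measures travel from one arm to the other through
  the junction; the last combination sets the stem against both arms of the cycle.\<close>

lemma star_edge_lipschitz:
  assumes "{u, v} \<in> star_edges"
  shows "\<bar>int (\<alpha> v) - int (\<alpha> u)\<bar> \<le> 1"
    "\<bar>int (\<beta> v) - int (\<beta> u)\<bar> \<le> 1"
    "\<bar>int (\<gamma> v) - int (\<gamma> u)\<bar> \<le> 1"
    "\<bar>(int (\<gamma> v) - int (\<beta> v)) - (int (\<gamma> u) - int (\<beta> u))\<bar> \<le> 1"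
    "\<bar>(int (\<beta> v) - int (\<gamma> v)) - (int (\<beta> u) - int (\<gamma> u))\<bar> \<le> 1"
    "\<bar>(int (\<beta> v) - int (\<alpha> v)) - (int (\<beta> u) - int (\<alpha> u))\<bar> \<le> 1"
    "\<bar>(int (\<gamma> v) - int (\<alpha> v)) - (int (\<gamma> u) - int (\<alpha> u))\<bar> \<le> 1"
    "\<bar>(int (\<alpha> v) + int (\<beta> v) - int (\<gamma> v)) - (int (\<alpha> u) + int (\<beta> u) - int (\<gamma> u))\<bar> \<le> 1"
  using assms by (cases rule: star_edge_cases; simp)+

lemma tadpole_edge_iff:
  assumes "\<alpha> v < A" "\<beta> v < B" "\<gamma> v < C"
  shows "{v, w} \<in> edges (tadpole A B C) \<longleftrightarrow> {v, w} \<in> star_edges"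
  using assms
  by (auto simp: tadpole_def star_edges_def doubleton_eq_iff)

text \<open>Only at a tip does a tadpole differ locally from the star, and the strict bounds exclude
  the tips. Hence tadpoles cut beyond the observed depths are indistinguishable.\<close>

lemma observe_tadpole:
  assumes "\<alpha> v < A" "\<beta> v < B" "\<gamma> v < C"
  shows "observe (tadpole A B C) v = (v, {(w, 1) | w. {v, w} \<in> star_edges})"
  using tadpole_edge_iff[OF assms] by (simp add: observe_def) (simp add: tadpole_def)

lemma tadpole_edge_cases:
  assumes "{u, v} \<in> edges (tadpole A B C)"
  shows "{u, v} \<in> star_edges \<or> u = a A \<and> v = b B \<or> u = b B \<and> v = a A"
  using assms by (auto simp: tadpole_def star_edges_def doubleton_eq_iff)

lemma star_edge_arm:
  assumes "0 < m"
  shows "{a m, w} \<in> star_edges \<longleftrightarrow> w = a (m - 1) \<or> w = a (Suc m)"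
proof
  assume "{a m, w} \<in> star_edges"
  then show "w = a (m - 1) \<or> w = a (Suc m)"
    using assms by (auto simp: star_edges_def doubleton_eq_iff a_b_eq a_c_eq)
next
  assume "w = a (m - 1) \<or> w = a (Suc m)"
  moreover have "{a m, a (m - 1)} \<in> star_edges"
    using assms unfolding star_edges_def by (cases m) (auto simp: insert_commute)
  ultimately show "{a m, w} \<in> star_edges" by (auto simp: star_edges_def)
qed

lemma is_tadpole_tadpole:
  assumes "1 \<le> A" "1 \<le> B" "1 \<le> C"
  shows "is_tadpole (A + B + 1) C (tadpole A B C)"
proof -
  \<comment> \<open>Once round the cycle from the junction: out along \<open>a\<close>, over the
    closing edge, back along \<open>b\<close>. At \<open>A + B + 1\<close> the value is
    \<open>b 0\<close>, the junction again, so the wraparound edge needs no separate form.\<close>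
  define g where "g k = (if k \<le> A then a k else b (A + B + 1 - k))" for k
  define cyc where "cyc = map g [0..<A + B + 1]"
  define stem where "stem = map (\<lambda>k. c (Suc k)) [0..<C]"
  have g_b: "g (A + B + 1 - m) = b m" if "m \<le> B" for m
    using that by (auto simp: g_def)
  have wrap: "g (A + B + 1) = g 0" using assms by (simp add: g_def centre)
  have nth: "cyc ! k = g k" if "k < A + B + 1" for k
    using that unfolding cyc_def by (simp del: upt_Suc)
  have nth_Suc: "cyc ! (Suc k mod (A + B + 1)) = g (Suc k)" if "k < A + B + 1" for k
  proof (cases "Suc k = A + B + 1")
    case True
    then show ?thesis using nth[of 0] wrap by simp
  next
    case False
    then show ?thesis using that nth[of "Suc k"] by simp
  qed
  have cyc_edges: "{{cyc ! k, cyc ! (Suc k mod (A + B + 1))} | k. k < A + B + 1} =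
      {{a k, a (Suc k)} | k. k < A} \<union> {{b k, b (Suc k)} | k. k < B} \<union> {{a A, b B}}" (is "?L = ?R")
  proof -
    have pair: "{cyc ! k, cyc ! (Suc k mod (A + B + 1))} = {g k, g (Suc k)}"
      if "k < A + B + 1" for k
      by (simp only: nth[OF that] nth_Suc[OF that])
    have "?L = {{g k, g (Suc k)} | k. k < A + B + 1}"
      unfolding setcompr_eq_image by (rule image_cong) (simp_all only: pair mem_Collect_eq)
    also have "\<dots> = ?R"
    proof (intro subset_antisym subsetI)
      fix e assume "e \<in> {{g k, g (Suc k)} | k. k < A + B + 1}"
      then obtain k where k: "k < A + B + 1" "e = {g k, g (Suc k)}" by auto
      consider "k < A" | "k = A" | "A < k" by linarith
      then show "e \<in> ?R"
      proof cases
        case 1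
        then have "e = {a k, a (Suc k)}" using k(2) by (simp add: g_def)
        then show ?thesis using 1 by blast
      next
        case 2
        then have "e = {a A, b B}" using k(2) by (simp add: g_def)
        then show ?thesis by simp
      next
        case 3
        then have "g k = b (Suc (A + B - k))" "g (Suc k) = b (A + B - k)" and less: "A + B - k < B"
          using k(1) by (simp_all add: g_def Suc_diff_le)
        then have "e = {b (A + B - k), b (Suc (A + B - k))}" using k(2) by (simp add: insert_commute)
        then show ?thesis using less by blast
      qed
    next
      fix e assume "e \<in> ?R"
      then consider k where "k < A" "e = {a k, a (Suc k)}" | k where "k < B" "e = {b k, b (Suc k)}"
        | "e = {a A, b B}" by auto
      then show "e \<in> {{g k, g (Suc k)} | k. k < A + B + 1}"
      proof cases
        case 1
        then have "e = {g k, g (Suc k)}" by (simp add: g_def)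
        then show ?thesis using 1 by (intro CollectI exI[of _ k]) simp
      next
        case 2
        then have "e = {g (A + B - k), g (Suc (A + B - k))}"
          using g_b[of k] g_b[of "Suc k"] by (auto simp: Suc_diff_le)
        then show ?thesis using 2 by (intro CollectI exI[of _ "A + B - k"]) simp
      next
        case 3
        then have "e = {g A, g (Suc A)}" by (simp add: g_def)
        then show ?thesis by (intro CollectI exI[of _ A]) simp
      qed
    qed
    finally show ?thesis .
  qed
  have stem_nth: "stem ! k = c (Suc k)" if "k < C" for k
    using that by (simp add: stem_def)
  have stem_edges: "{{cyc ! 0, stem ! 0}} \<union> {{stem ! k, stem ! Suc k} | k. Suc k < C} =
      {{c k, c (Suc k)} | k. k < C}" (is "?L = ?R")
  proof (intro subset_antisym subsetI)
    fix e assume "e \<in> ?L"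
    then consider "e = {c 0, c (Suc 0)}" | k where "Suc k < C" "e = {c (Suc k), c (Suc (Suc k))}"
      using assms nth[of 0] stem_nth by (auto simp: g_def centre)
    then show "e \<in> ?R" using assms by cases auto
  next
    fix e assume "e \<in> ?R"
    then obtain k where k: "k < C" "e = {c k, c (Suc k)}" by auto
    show "e \<in> ?L"
    proof (cases k)
      case 0
      then show ?thesis using k assms nth[of 0] stem_nth by (simp add: g_def centre)
    next
      case (Suc m)
      then have "e = {stem ! m, stem ! Suc m}" using k stem_nth by simp
      then show ?thesis using k Suc by blast
    qed
  qed
  have inj: "inj_on g {0..<A + B + 1}"
    by (auto simp: inj_on_def g_def a_b_eq split: if_splits)
  have disj: "g k \<noteq> c (Suc m)" if "k < A + B + 1" for k m
    by (auto simp: g_def a_c_eq b_c_eq)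
  have dist: "distinct (cyc @ stem)"
    using inj disj unfolding cyc_def stem_def
    by (auto simp: distinct_map inj_on_def simp del: upt_Suc)
  have set_cyc: "set cyc = a ` {..A} \<union> b ` {..B}"
  proof (intro subset_antisym subsetI)
    fix v assume "v \<in> set cyc"
    then show "v \<in> a ` {..A} \<union> b ` {..B}" unfolding cyc_def
      by (auto simp: g_def simp del: upt_Suc)
  next
    fix v assume "v \<in> a ` {..A} \<union> b ` {..B}"
    then consider k where "k \<le> A" "v = a k" | k where "k \<le> B" "v = b k" "0 < k"
      by (metis UnE atMost_iff centre(1) gr0I imageE le0)
    then show "v \<in> set cyc"
    proof cases
      case 1
      then have "v = g k" "k < A + B + 1" by (simp_all add: g_def)
      then show ?thesis unfolding cyc_def by (auto simp del: upt_Suc)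
    next
      case 2
      then have "v = g (A + B + 1 - k)" "A + B + 1 - k < A + B + 1" using g_b by auto
      then show ?thesis unfolding cyc_def by (auto simp del: upt_Suc)
    qed
  qed
  have set_stem: "set stem = c ` {1..C}"
    unfolding stem_def set_map set_upt image_image[symmetric, of c Suc]
    by (simp add: atLeastLessThanSuc_atLeastAtMost)
  have "{..C} = insert 0 {1..C}" by auto
  then have "c ` {..C} = insert (a 0) (c ` {1..C})"
    using centre by simp
  then have verts: "verts (tadpole A B C) = set (cyc @ stem)"
    using set_cyc set_stem by (auto simp: tadpole_def)
  have edges: "edges (tadpole A B C) = {{cyc ! k, cyc ! (Suc k mod (A + B + 1))} | k. k < A + B + 1}
      \<union> {{cyc ! 0, stem ! 0}} \<union> {{stem ! k, stem ! Suc k} | k. Suc k < C}"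
    unfolding cyc_edges Un_assoc stem_edges by (auto simp: tadpole_def)
  have "a A \<noteq> b B" using assms by (simp add: a_b_eq)
  then have "weighted_graph (tadpole A B C)"
    unfolding weighted_graph_def by (auto simp: tadpole_def)
  moreover have "length cyc = A + B + 1" "length stem = C" by (simp_all add: cyc_def stem_def)
  ultimately show ?thesis
    unfolding is_tadpole_def using dist verts edges assms
    by (intro conjI exI[of _ cyc] exI[of _ stem]) simp_all
qed

lemma tadpole_in_unit_tadpoles:
  assumes "1 \<le> A" "1 \<le> B" "1 \<le> C"
  shows "tadpole A B C \<in> unit_tadpoles"
proof -
  have "\<forall>e\<in>edges (tadpole A B C). weight (tadpole A B C) e = 1" by (simp add: tadpole_def)
  then show ?thesis using is_tadpole_tadpole[OF assms] unfolding unit_tadpoles_def by blast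
qed

lemma walk_cost_tadpole: "walk_cost (tadpole A B C) xs = real (length xs - 1)"
  by (simp add: walk_cost_def tadpole_def)

lemma cost_opt_tadpole_le:
  assumes "1 \<le> A" "1 \<le> B" "1 \<le> C" "N \<le> A"
  shows "cost_opt (tadpole A B C) (a N) \<le> real (A + B + 1 + 2 * C)"
proof -
  let ?G = "tadpole A B C"
  let ?E = "\<lambda>u v. {u, v} \<in> edges ?G"
  \<comment> \<open>To the junction, down the stem and back, out along \<open>b\<close>, over the
    closing edge and along \<open>a\<close> to the start: every cycle edge once, every stem edge
    twice.\<close>
  define tour where "tour = rev (map a [0..<Suc N]) @ map c [1..<Suc C] @ rev (map c [0..<C])
      @ map b [1..<Suc B] @ rev (map a [N..<Suc A])"
  have sym: "(\<lambda>u v. ?E v u) = ?E" by (simp add: insert_commute)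
  have aE: "?E (a k) (a (Suc k))" if "k < A" for k using that by (auto simp: tadpole_def)
  have bE: "?E (b k) (b (Suc k))" if "k < B" for k using that by (auto simp: tadpole_def)
  have cE: "?E (c k) (c (Suc k))" if "k < C" for k using that by (auto simp: tadpole_def)
  have closing: "?E (b B) (a A)" by (auto simp: tadpole_def)
  have path: "successively ?E (map f [m..<n])"
    if "\<And>k. m \<le> k \<Longrightarrow> Suc k < n \<Longrightarrow> ?E (f k) (f (Suc k))" for f :: "nat \<Rightarrow> nat" and m n
    using that by (auto simp: successively_conv_nth simp del: upt_Suc)
  have rev_path: "successively ?E (rev (map f [m..<n]))"
    if "\<And>k. m \<le> k \<Longrightarrow> Suc k < n \<Longrightarrow> ?E (f k) (f (Suc k))" for f :: "nat \<Rightarrow> nat" and m n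
    unfolding successively_rev sym by (rule path) (rule that)
  have ends: "hd (map f [m..<n]) = f m" "last (map f [m..<n]) = f (n - 1)"
    if "m < n" for f :: "nat \<Rightarrow> nat" and m n
    using that by (simp_all add: hd_map last_map)
  have joints: "?E (a 0) (c 1)" "?E (c C) (c (C - 1))" "?E (c 0) (b 1)"
    using cE[of 0] cE[of "C - 1"] bE[of 0] assms centre by (auto simp: insert_commute)
  have succ: "successively ?E tour"
    unfolding tour_def successively_append_iff
    using assms joints closing
    by (auto simp: hd_append ends hd_rev last_rev aE bE cE simp del: upt_Suc map_append successively_rev
        intro!: path rev_path)
  have len: "length tour = A + B + 2 * C + 2" using assms by (simp add: tour_def)
  have "{0..<Suc N} \<union> {N..<Suc A} = {..A}" using assms by auto
  then have "a ` {0..<Suc N} \<union> a ` {N..<Suc A} = a ` {..A}" by (metis image_Un)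
  moreover have "{1..<Suc C} \<union> {0..<C} = {..C}" using assms by auto
  then have "c ` {1..<Suc C} \<union> c ` {0..<C} = c ` {..C}" by (metis image_Un)
  moreover have "{..B} = insert 0 {1..<Suc B}" by auto
  then have "b ` {..B} = insert (a 0) (b ` {1..<Suc B})" using centre by simp
  ultimately have set_tour: "set tour = verts ?G"
    by (auto simp: tour_def tadpole_def simp del: upt_Suc)
  have hl: "hd tour = a N" "last tour = a N"
    using assms by (auto simp: tour_def hd_append hd_rev last_append last_rev hd_map last_map simp del: upt_Suc)
  have tour: "exploration_tour ?G (a N) tour"
    using succ set_tour hl len by (auto simp: exploration_tour_def walk_def successively_conv_nth)
  have "weighted_graph ?G" using is_tadpole_tadpole[OF assms(1-3)] by (simp add: is_tadpole_def)
  from cost_opt_attained[OF this tour] have "cost_opt ?G (a N) \<le> walk_cost ?G tour"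
    using tour by metis
  then show ?thesis using len by (simp add: walk_cost_tadpole)
qed

end

section \<open>Lower bounds for runs on the star\<close>

text \<open>A run that looks like an exploration of the infinite star up to time \<open>T\<close>: the junction is
  first reached at time \<open>tJ\<close>, and \<open>a (N + x)\<close> is the furthest vertex beyond the start seen until
  then, visited at time \<open>tx\<close>.\<close>

locale star_run = star +
  fixes Alg :: algorithm and H :: wgraph and xs :: "nat list" and N x tx tJ T :: nat
  assumes explores: "explores Alg unit_tadpoles"
    and N_pos: "0 < N"
    and prod: "produces Alg H (a N) xs"
    and T_less: "T < length xs"
    and obs: "k < T \<Longrightarrow> observe H (xs ! k) = (xs ! k, {(w, 1) | w. {xs ! k, w} \<in> star_edges})"
    and step: "k < T \<Longrightarrow> {xs ! k, xs ! Suc k} \<in> star_edges"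
    and region: "k < T \<Longrightarrow> xs ! k \<in> a ` {..N + x} \<union> b ` {..<N + x} \<union> c ` {..<N + x}"
    and before: "k < tJ \<Longrightarrow> xs ! k \<in> range a"
    and times: "tx \<le> tJ" "tJ < T"
    and at_tx: "xs ! tx = a (N + x)"
    and at_tJ: "xs ! tJ = a 0"
begin

text \<open>The run treats \<open>b\<close> and \<open>c\<close> alike; only the tadpole
  distinguishes them. Facts about one unknown arm thus transfer to the other.\<close>

lemma swap_run: "star_run a c b \<alpha> \<gamma> \<beta> Alg H xs N x tx tJ T"
proof -
  interpret sw: star a c b \<alpha> \<gamma> \<beta> by (rule swap)
  have "sw.star_edges = star_edges" by (auto simp: star_edges_def sw.star_edges_def)
  moreover have "xs ! k \<in> a ` {..N + x} \<union> c ` {..<N + x} \<union> b ` {..<N + x}" if "k < T" for k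
    using region[OF that] by blast
  ultimately show ?thesis
    using explores N_pos prod T_less obs step before times at_tx at_tJ
    by unfold_locales auto
qed

lemma hd_run: "xs ! 0 = a N"
  using prod by (auto simp: produces_def hd_conv_nth)

lemma steps_le:
  fixes f :: "nat \<Rightarrow> int"
  assumes "m \<le> n" "n \<le> T" "\<And>u v. {u, v} \<in> star_edges \<Longrightarrow> \<bar>f v - f u\<bar> \<le> 1"
  shows "f (xs ! n) - f (xs ! m) \<le> int n - int m" "f (xs ! m) - f (xs ! n) \<le> int n - int m"
  by (rule diff_le_steps[of m n "\<lambda>k. f (xs ! k)"]; use assms step in auto)+

text \<open>The depth in arm \<open>a\<close> first rises from \<open>N\<close> to
  \<open>N + x\<close> and then falls to 0.\<close>

lemma time_centre: "int N + 2 * int x \<le> int tJ"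
proof -
  have "int (\<alpha> (xs ! tx)) - int (\<alpha> (xs ! 0)) \<le> int tx - int 0"
    by (intro steps_le(1) star_edge_lipschitz) (use times in auto)
  moreover have "int (\<alpha> (xs ! tx)) - int (\<alpha> (xs ! tJ)) \<le> int tJ - int tx"
    by (intro steps_le(2) star_edge_lipschitz) (use times in auto)
  ultimately show ?thesis by (simp add: at_tx at_tJ hd_run)
qed

lemma deepest_c:
  obtains p tp where "tJ \<le> tp" "tp < T" "xs ! tp = c p" "\<And>k. k < T \<Longrightarrow> \<gamma> (xs ! k) \<le> p"
proof -
  define p where "p = Max ((\<lambda>k. \<gamma> (xs ! k)) ` {..<T})"
  have ne: "(\<lambda>k. \<gamma> (xs ! k)) ` {..<T} \<noteq> {}" using times by auto
  have max: "\<gamma> (xs ! k) \<le> p" if "k < T" for k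
    unfolding p_def using that by (intro Max_ge) auto
  have "p \<in> (\<lambda>k. \<gamma> (xs ! k)) ` {..<T}"
    unfolding p_def using ne by (intro Max_in) auto
  then obtain tp where tp: "tp < T" "\<gamma> (xs ! tp) = p" by auto
  show thesis
  proof (cases "p = 0")
    \<comment> \<open>This covers an arm never entered: \<open>c 0\<close> is the junction, so depth
      0 is attained at \<open>tJ\<close>. A positive depth occurs only after \<open>tJ\<close>,
      since until then only arm \<open>a\<close> is visited.\<close>
    case True
    then show ?thesis using that[of tJ 0] max times at_tJ centre by simp
  next
    case False
    then have "xs ! tp = c p" using region[OF tp(1)] tp(2) by auto
    moreover have "tJ \<le> tp"
      using before[of tp] tp(2) False by (cases "tp < tJ") auto
    ultimately show ?thesis using that tp(1) max by blast
  qed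
qed

text \<open>Up to its arrival at \<open>xs ! T\<close>, which may be a tip of a cycle arm, the
  searcher cannot tell the tadpole from \<open>H\<close>. The end of the stem is still unvisited
  then, so the searcher has yet to go there and return to the start.\<close>

lemma response:
  assumes "1 \<le> A" "1 \<le> B" "1 \<le> C" "N \<le> A" "\<gamma> (xs ! T) < C"
    and "\<And>k. k < T \<Longrightarrow> \<alpha> (xs ! k) < A" "\<And>k. k < T \<Longrightarrow> \<beta> (xs ! k) < B"
      "\<And>k. k < T \<Longrightarrow> \<gamma> (xs ! k) < C"
  obtains ys t where "walk (tadpole A B C) ys" "cost_alg Alg (tadpole A B C) (a N) = real (length ys - 1)"
    "ys ! T = xs ! T" "T < t" "t < length ys" "ys ! t = c C" "ys ! (length ys - 1) = a N"
proof -
  let ?G = "tadpole A B C"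
  have "?G \<in> unit_tadpoles" "a N \<in> verts ?G"
    using tadpole_in_unit_tadpoles assms by (auto, simp add: tadpole_def)
  then obtain ys where ys: "produces Alg ?G (a N) ys" "exploration_tour ?G (a N) ys"
    using explores unfolding explores_def by blast
  have "T < length ys \<and> take (Suc T) ys = take (Suc T) xs"
    by (rule produces_prefix[OF prod ys(1) T_less]) (simp add: obs observe_tadpole assms)
  then have T: "T < length ys" and eq: "ys ! k = xs ! k" if "k \<le> T" for k
    using that by (auto, metis le_imp_less_Suc nth_take)
  have "c C \<in> set ys" using ys(2) by (simp add: exploration_tour_def tadpole_def)
  then obtain t where t: "t < length ys" "ys ! t = c C" by (auto simp: in_set_conv_nth)
  have "T < t"
  proof (rule ccontr)
    assume "\<not> T < t"
    then have "\<gamma> (ys ! t) < C" using eq[of t] assms(5,8) by (cases "t = T") auto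
    then show False using t by simp
  qed
  moreover have "ys ! (length ys - 1) = a N"
    using ys by (metis exploration_tour_def last_conv_nth produces_def)
  moreover have "walk ?G ys" using ys(2) by (simp add: exploration_tour_def)
  moreover have "cost_alg Alg ?G (a N) = real (length ys - 1)"
    using cost_alg_eq[OF ys(1)] by (simp add: walk_cost_tadpole)
  ultimately show thesis using that t eq by blast
qed

text \<open>\<open>U\<close> bounds the optimum, and \<open>N \<le> U\<close> makes the additive
  loss negligible for large \<open>N\<close>. The 7 is the loss in \<open>beaten_past_start\<close>
  for \<open>x = 0\<close>: there \<open>2 * U\<close> has the constant term 10, the bound on the
  cost 3.\<close>

definition beaten :: bool where
  "beaten \<longleftrightarrow> (\<exists>G\<in>unit_tadpoles. \<exists>U. a N \<in> verts G \<and> N \<le> U \<and> cost_opt G (a N) \<le> real U \<and>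
     2 * real U - 7 \<le> cost_alg Alg G (a N))"

lemma beatenI:
  assumes "1 \<le> A" "1 \<le> B" "1 \<le> C" "N \<le> A"
    and "2 * real (A + B + 1 + 2 * C) - 7 \<le> cost_alg Alg (tadpole A B C) (a N)"
  shows beaten
  unfolding beaten_def
proof (intro bexI[of _ "tadpole A B C"] exI[of _ "A + B + 1 + 2 * C"] conjI)
  show "a N \<in> verts (tadpole A B C)" using assms by (simp add: tadpole_def)
qed (use assms cost_opt_tadpole_le tadpole_in_unit_tadpoles in auto)

lemma beaten_deep_b:
  assumes at_T: "xs ! T = b (N + x)"
  shows beaten
proof -
  obtain p tp where p: "tJ \<le> tp" "tp < T" "xs ! tp = c p" "\<And>k. k < T \<Longrightarrow> \<gamma> (xs ! k) \<le> p"
    using deepest_c by blast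
  \<comment> \<open>The vertices \<open>a (N + x)\<close> and \<open>c p\<close> have been observed,
    so these arms must go one vertex further; \<open>b (N + x)\<close> has only just been reached
    and can be a tip.\<close>
  let ?A = "N + x + 1" and ?B = "N + x" and ?C = "p + 1"
  let ?G = "tadpole ?A ?B ?C"
  have pre: "1 \<le> ?A" "1 \<le> ?B" "1 \<le> ?C" "N \<le> ?A" "\<gamma> (xs ! T) < ?C"
    using N_pos at_T by simp_all
  have depths: "\<alpha> (xs ! k) < ?A" "\<beta> (xs ! k) < ?B" "\<gamma> (xs ! k) < ?C" if "k < T" for k
    using region[OF that] p(4)[OF that] N_pos by auto
  obtain ys t where ys: "walk ?G ys" "cost_alg Alg ?G (a N) = real (length ys - 1)"
    "ys ! T = xs ! T" "T < t" "t < length ys" "ys ! t = c ?C" "ys ! (length ys - 1) = a N"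
    using response[OF pre depths] by blast
  \<comment> \<open>After \<open>N + 2 * x\<close> steps to the junction: \<open>p\<close> steps
    down arm \<open>c\<close>, then \<open>p + N + x\<close> back through the junction into arm
    \<open>b\<close>.\<close>
  have "int (\<gamma> (xs ! tp)) - int (\<gamma> (xs ! tJ)) \<le> int tp - int tJ"
    by (intro steps_le(1) star_edge_lipschitz) (use p in auto)
  moreover have "(int (\<gamma> (xs ! tp)) - int (\<beta> (xs ! tp))) - (int (\<gamma> (xs ! T)) - int (\<beta> (xs ! T)))
      \<le> int T - int tp"
    by (intro steps_le(2) star_edge_lipschitz) (use p in auto)
  ultimately have T: "2 * int N + 3 * int x + 2 * int p \<le> int T"
    using time_centre p(3) at_tJ at_T by simp
  \<comment> \<open>1-Lipschitz also along the closing edge, whose ends are at depths \<open>N + x + 1\<close> and \<open>N + x\<close>.\<close>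
  define f where "f v = int (\<alpha> v) + int (\<beta> v) - int (\<gamma> v)" for v
  have f: "\<bar>f v - f u\<bar> \<le> 1" if "{u, v} \<in> edges ?G" for u v
    using tadpole_edge_cases[OF that] star_edge_lipschitz(8)[of u v] unfolding f_def by auto
  \<comment> \<open>\<open>f\<close> is \<open>N + x\<close> at time \<open>T\<close>,
    \<open>- (p + 1)\<close> at the end of the stem and \<open>N\<close> at the start, whichever way
    round the cycle is taken.\<close>
  have "f (ys ! T) - f (ys ! t) \<le> int t - int T"
    using ys by (intro diff_le_steps(2)[of T t "\<lambda>k. f (ys ! k)"] f) (auto simp: walk_def)
  moreover have "f (ys ! (length ys - 1)) - f (ys ! t) \<le> int (length ys - 1) - int t"
    using ys by (intro diff_le_steps(1)[of t "length ys - 1" "\<lambda>k. f (ys ! k)"] f) (auto simp: walk_def)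
  ultimately have "4 * int N + 4 * int x + 4 * int p + 2 \<le> int (length ys - 1)"
    using T ys at_T by (simp add: f_def)
  then show ?thesis using ys(2) N_pos by (intro beatenI[of ?A ?B ?C]) auto
qed

lemma beaten_past_start:
  assumes at_T: "xs ! T = a (N + x + 1)"
  shows beaten
proof -
  interpret sw: star_run a c b \<alpha> \<gamma> \<beta> Alg H xs N x tx tJ T by (rule swap_run)
  obtain p tp where p: "tJ \<le> tp" "tp < T" "xs ! tp = c p" "\<And>k. k < T \<Longrightarrow> \<gamma> (xs ! k) \<le> p"
    using deepest_c by blast
  obtain q tq where q: "tJ \<le> tq" "tq < T" "xs ! tq = b q" "\<And>k. k < T \<Longrightarrow> \<beta> (xs ! k) \<le> q"
    using sw.deepest_c by blast
  \<comment> \<open>Here \<open>a (N + x + 1)\<close> is the vertex reached but not yet observed;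
    both other arms end just beyond what was explored.\<close>
  let ?A = "N + x + 1" and ?B = "q + 1" and ?C = "p + 1"
  let ?G = "tadpole ?A ?B ?C"
  have pre: "1 \<le> ?A" "1 \<le> ?B" "1 \<le> ?C" "N \<le> ?A" "\<gamma> (xs ! T) < ?C"
    using N_pos at_T by simp_all
  have depths: "\<alpha> (xs ! k) < ?A" "\<beta> (xs ! k) < ?B" "\<gamma> (xs ! k) < ?C" if "k < T" for k
    using region[OF that] p(4)[OF that] q(4)[OF that] by auto
  obtain ys t where ys: "walk ?G ys" "cost_alg Alg ?G (a N) = real (length ys - 1)"
    "ys ! T = xs ! T" "T < t" "t < length ys" "ys ! t = c ?C" "ys ! (length ys - 1) = a N"
    using response[OF pre depths] by blast
  \<comment> \<open>In either order of \<open>tp\<close> and \<open>tq\<close>, the legs after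
    \<open>tJ\<close> lead from the junction to one deepest point, then to the other, then to
    \<open>a (N + x + 1)\<close>. Together they take at least
    \<open>2 * p + 2 * q + N + x + 1\<close> steps.\<close>
  have T: "2 * int N + 3 * int x + 2 * int p + 2 * int q + 1 \<le> int T"
  proof (cases "tp \<le> tq")
    case True
    have "int (\<gamma> (xs ! tp)) - int (\<gamma> (xs ! tJ)) \<le> int tp - int tJ"
      by (intro steps_le(1) star_edge_lipschitz) (use p in auto)
    moreover have "(int (\<gamma> (xs ! tp)) - int (\<beta> (xs ! tp))) - (int (\<gamma> (xs ! tq)) - int (\<beta> (xs ! tq)))
        \<le> int tq - int tp"
      by (intro steps_le(2) star_edge_lipschitz) (use q True in auto)
    moreover have "(int (\<beta> (xs ! tq)) - int (\<alpha> (xs ! tq))) - (int (\<beta> (xs ! T)) - int (\<alpha> (xs ! T)))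
        \<le> int T - int tq"
      by (intro steps_le(2) star_edge_lipschitz) (use q in auto)
    ultimately show ?thesis using time_centre p(3) q(3) at_tJ at_T by simp
  next
    case False
    have "int (\<beta> (xs ! tq)) - int (\<beta> (xs ! tJ)) \<le> int tq - int tJ"
      by (intro steps_le(1) star_edge_lipschitz) (use q in auto)
    moreover have "(int (\<beta> (xs ! tq)) - int (\<gamma> (xs ! tq))) - (int (\<beta> (xs ! tp)) - int (\<gamma> (xs ! tp)))
        \<le> int tp - int tq"
      by (intro steps_le(2) star_edge_lipschitz) (use p False in auto)
    moreover have "(int (\<gamma> (xs ! tp)) - int (\<alpha> (xs ! tp))) - (int (\<gamma> (xs ! T)) - int (\<alpha> (xs ! T)))
        \<le> int T - int tp"
      by (intro steps_le(2) star_edge_lipschitz) (use p in auto)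
    ultimately show ?thesis using time_centre p(3) q(3) at_tJ at_T by simp
  qed
  \<comment> \<open>Both ends of the closing edge have stem depth 0, so \<gamma> stays 1-Lipschitz;
    going to the end of the stem and back costs \<open>2 * (p + 1)\<close> more.\<close>
  have f: "\<bar>int (\<gamma> v) - int (\<gamma> u)\<bar> \<le> 1" if "{u, v} \<in> edges ?G" for u v
    using tadpole_edge_cases[OF that] star_edge_lipschitz(3)[of u v] by auto
  have "int (\<gamma> (ys ! t)) - int (\<gamma> (ys ! T)) \<le> int t - int T"
    using ys by (intro diff_le_steps(1)[of T t "\<lambda>k. int (\<gamma> (ys ! k))"] f) (auto simp: walk_def)
  moreover have "int (\<gamma> (ys ! t)) - int (\<gamma> (ys ! (length ys - 1))) \<le> int (length ys - 1) - int t"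
    using ys by (intro diff_le_steps(2)[of t "length ys - 1" "\<lambda>k. int (\<gamma> (ys ! k))"] f)
      (auto simp: walk_def)
  ultimately have "2 * int N + 3 * int x + 4 * int p + 2 * int q + 3 \<le> int (length ys - 1)"
    using T ys at_T by simp
  then show ?thesis using ys(2) by (intro beatenI[of ?A ?B ?C]) auto
qed

lemma beaten_deep_c:
  assumes "xs ! T = c (N + x)"
  shows beaten
proof -
  interpret sw: star_run a c b \<alpha> \<gamma> \<beta> Alg H xs N x tx tJ T by (rule swap_run)
  show ?thesis using sw.beaten_deep_b[OF assms] by (simp add: beaten_def sw.beaten_def)
qed

end

section \<open>Placing the junction\<close>

context star
begin

text \<open>The excluded vertices are the two candidate junctions, at distance \<open>N\<close> on
  either side of the start.\<close>

lemma in_arm_before: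
  assumes N: "0 < N" and walk: "walk (tadpole (2 * N + 1) (2 * N + 1) (2 * N + 1)) xs"
    and hd: "hd xs = a N" and n: "n \<le> length xs"
    and notin: "\<And>k. k < n \<Longrightarrow> xs ! k \<notin> {a 0, a (2 * N)}" and k: "k < n"
  shows "xs ! k \<in> a ` {0<..<2 * N}"
proof (rule stays_in_region[OF walk _ _ _ notin k])
  show "hd xs \<in> a ` {0<..<2 * N}" using hd N by auto
  fix u v assume "u \<in> a ` {0<..<2 * N}" "{u, v} \<in> edges (tadpole (2 * N + 1) (2 * N + 1) (2 * N + 1))"
  then obtain m where m: "0 < m" "m < 2 * N" "u = a m" "{a m, v} \<in> star_edges"
    using tadpole_edge_iff[of u "2 * N + 1" "2 * N + 1" "2 * N + 1" v] by auto
  then have "v = a (m - 1) \<or> v = a (Suc m)" using star_edge_arm by blast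
  moreover have "m - 1 = 0 \<or> m - 1 \<in> {0<..<2 * N}" "Suc m = 2 * N \<or> Suc m \<in> {0<..<2 * N}"
    using m by auto
  ultimately show "v \<in> a ` {0<..<2 * N} \<union> {a 0, a (2 * N)}" by auto
qed (use n in auto)

text \<open>Arms of length \<open>2 * N + 1\<close> can stand for infinite ones:
  \<open>a (2 * N)\<close> is not visited before the junction, so \<open>N + x < 2 * N\<close>, and
  no tip is observed before \<open>T\<close>.\<close>

lemma centre_first_beaten:
  assumes expl: "explores Alg unit_tadpoles" and N: "0 < N"
    and prod: "produces Alg (tadpole (2 * N + 1) (2 * N + 1) (2 * N + 1)) (a N) xs"
    and tour: "exploration_tour (tadpole (2 * N + 1) (2 * N + 1) (2 * N + 1)) (a N) xs"
    and tJ: "tJ < length xs" "xs ! tJ = a 0" "\<And>k. k < tJ \<Longrightarrow> xs ! k \<notin> {a 0, a (2 * N)}"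
  shows "\<exists>G\<in>unit_tadpoles. \<exists>U. a N \<in> verts G \<and> N \<le> U \<and> cost_opt G (a N) \<le> real U \<and>
     2 * real U - 7 \<le> cost_alg Alg G (a N)"
proof -
  let ?H = "tadpole (2 * N + 1) (2 * N + 1) (2 * N + 1)"
  have walk: "walk ?H xs" and hd: "hd xs = a N" and set: "set xs = verts ?H"
    using tour by (auto simp: exploration_tour_def)
  have start: "xs ! 0 = a N" using hd walk by (simp add: walk_def hd_conv_nth)
  have tJ_pos: "0 < tJ" using tJ(2) start N by (cases tJ) auto
  have arm: "xs ! k \<in> a ` {0<..<2 * N}" if "k < tJ" for k
    using in_arm_before[OF N walk hd _ tJ(3) that] tJ(1) by simp
  define d where "d = Max ((\<lambda>k. \<alpha> (xs ! k)) ` {..<tJ})"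
  have d_max: "\<alpha> (xs ! k) \<le> d" if "k < tJ" for k
    unfolding d_def using that by (intro Max_ge) auto
  have "d \<in> (\<lambda>k. \<alpha> (xs ! k)) ` {..<tJ}"
    unfolding d_def using tJ_pos by (intro Max_in) auto
  then obtain tx where tx: "tx < tJ" "\<alpha> (xs ! tx) = d" by auto
  \<comment> \<open>The start is visited before \<open>tJ\<close>, so \<open>N \<le> d\<close> and
    the subtraction is not truncated.\<close>
  define x where "x = d - N"
  have d: "d = N + x" using d_max[OF tJ_pos] start by (simp add: x_def)
  have at_tx: "xs ! tx = a (N + x)" using arm[OF tx(1)] tx(2) d by auto
  have d_less: "N + x < 2 * N" using arm[OF tx(1)] at_tx by auto
  \<comment> \<open>The events that end the run: depth \<open>N + x\<close> in an unknown arm, or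
    one vertex past the furthest seen beyond the start. One of them occurs because the tour has to
    visit \<open>b (N + x)\<close>.\<close>
  define W where "W = {b (N + x), c (N + x), a (N + x + 1)}"
  have "b (N + x) \<in> set xs" unfolding set using d_less by (auto simp: tadpole_def)
  then have ex: "\<exists>k. k < length xs \<and> xs ! k \<in> W" by (auto simp: in_set_conv_nth W_def)
  define T where "T = (LEAST k. k < length xs \<and> xs ! k \<in> W)"
  have T: "T < length xs" "xs ! T \<in> W" using LeastI_ex[OF ex] by (auto simp: T_def)
  have T_min: "xs ! k \<notin> W" if "k < T" for k
    using not_less_Least[of k "\<lambda>k. k < length xs \<and> xs ! k \<in> W"] that T by (auto simp: T_def)
  have "xs ! k \<notin> W" if "k \<le> tJ" for k
  proof (cases "k = tJ")
    case True
    then show ?thesis using tJ N by (auto simp: W_def a_b_eq a_c_eq)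
  next
    case False
    then have "k < tJ" using that by simp
    then have "0 < \<alpha> (xs ! k)" "\<alpha> (xs ! k) \<le> N + x" using arm[of k] d_max[of k] d by auto
    then show ?thesis by (auto simp: W_def)
  qed
  then have tJ_T: "tJ < T" using T(2) by (meson not_le)
  let ?S = "a ` {..N + x} \<union> b ` {..<N + x} \<union> c ` {..<N + x}"
  have star_edge: "{u, v} \<in> star_edges" if "u \<in> ?S" "{u, v} \<in> edges ?H" for u v
    using that d_less tadpole_edge_iff[of u "2 * N + 1" "2 * N + 1" "2 * N + 1" v] by auto
  have region: "xs ! k \<in> ?S" if "k < T" for k
  proof (rule stays_in_region[OF walk _ _ _ T_min that])
    show "hd xs \<in> ?S" using hd by simp
    fix u v assume u: "u \<in> ?S" and e: "{u, v} \<in> edges ?H"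
    have "\<alpha> u \<le> N + x" "\<beta> u < N + x" "\<gamma> u < N + x" using u N by auto
    from star_edge[OF u e] this have "v \<in> a ` {..Suc (N + x)} \<union> b ` {..N + x} \<union> c ` {..N + x}"
      by (cases rule: star_edge_cases) auto
    moreover have "a ` {..Suc (N + x)} = insert (a (N + x + 1)) (a ` {..N + x})"
      by (simp add: atMost_Suc)
    moreover have "f ` {..N + x} = insert (f (N + x)) (f ` {..<N + x})" for f :: "nat \<Rightarrow> nat"
      by (metis image_insert lessThan_Suc lessThan_Suc_atMost)
    ultimately show "v \<in> ?S \<union> W" unfolding W_def by blast
  qed (use T in auto)
  interpret star_run a b c \<alpha> \<beta> \<gamma> Alg ?H xs N x tx tJ T
  proof
    fix k
    show "k < tJ \<Longrightarrow> xs ! k \<in> range a" using arm by auto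
    assume k: "k < T"
    have "\<alpha> (xs ! k) < 2 * N + 1" "\<beta> (xs ! k) < 2 * N + 1" "\<gamma> (xs ! k) < 2 * N + 1"
      using region[OF k] d_less by auto
    then show "observe ?H (xs ! k) = (xs ! k, {(w, 1) | w. {xs ! k, w} \<in> star_edges})"
      by (rule observe_tadpole)
    show "{xs ! k, xs ! Suc k} \<in> star_edges"
      using walk k T by (intro star_edge region) (auto simp: walk_def)
  qed (use expl N prod T region tx tJ_T at_tx tJ in auto)
  have beaten
    using T(2) beaten_deep_b beaten_deep_c beaten_past_start by (auto simp: W_def)
  then show ?thesis by (simp add: beaten_def)
qed

text \<open>Being its own inverse, \<sigma> also converts the depth functions.\<close>

lemma reflect:
  assumes "\<And>v. \<sigma> (\<sigma> v) = v"
  shows "star (\<sigma> \<circ> a) (\<sigma> \<circ> b) (\<sigma> \<circ> c) (\<alpha> \<circ> \<sigma>) (\<beta> \<circ> \<sigma>) (\<gamma> \<circ> \<sigma>)"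
  by unfold_locales (simp_all add: assms centre)

text \<open>If the searcher reaches \<open>a (2 * N)\<close> before \<open>a 0\<close>, the adversary plays on the mirror image
  instead, in which \<open>a (2 * N)\<close> is the junction; up to then both look the same.\<close>

lemma adversary_beats:
  assumes expl: "explores Alg unit_tadpoles" and N: "0 < N"
    and invol: "\<And>v. \<sigma> (\<sigma> v) = v" and mirror: "\<And>m. m \<le> 2 * N \<Longrightarrow> \<sigma> (a m) = a (2 * N - m)"
  shows "\<exists>G\<in>unit_tadpoles. \<exists>U. a N \<in> verts G \<and> N \<le> U \<and> cost_opt G (a N) \<le> real U \<and>
     2 * real U - 7 \<le> cost_alg Alg G (a N)"
proof -
  let ?M = "2 * N + 1"
  let ?G = "tadpole ?M ?M ?M"
  have "?G \<in> unit_tadpoles" "a N \<in> verts ?G"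
    by (simp add: tadpole_in_unit_tadpoles) (simp add: tadpole_def)
  then obtain xs where xs: "produces Alg ?G (a N) xs" "exploration_tour ?G (a N) xs"
    using expl unfolding explores_def by blast
  have walk: "walk ?G xs" and hd: "hd xs = a N" and set: "set xs = verts ?G"
    using xs(2) by (auto simp: exploration_tour_def)
  have "a 0 \<in> set xs" unfolding set by (simp add: tadpole_def)
  then have ex: "\<exists>k. k < length xs \<and> xs ! k \<in> {a 0, a (2 * N)}" by (auto simp: in_set_conv_nth)
  define t where "t = (LEAST k. k < length xs \<and> xs ! k \<in> {a 0, a (2 * N)})"
  have t: "t < length xs" "xs ! t \<in> {a 0, a (2 * N)}" using LeastI_ex[OF ex] by (auto simp: t_def)
  have t_min: "xs ! k \<notin> {a 0, a (2 * N)}" if "k < t" for k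
    using not_less_Least[of k "\<lambda>k. k < length xs \<and> xs ! k \<in> {a 0, a (2 * N)}"] that t
    by (auto simp: t_def)
  show ?thesis
  proof (cases "xs ! t = a 0")
    case True
    show ?thesis by (rule centre_first_beaten[OF expl N xs t(1) True t_min])
  next
    case False
    then have at_t: "xs ! t = a (2 * N)" using t by simp
    interpret m: star "\<sigma> \<circ> a" "\<sigma> \<circ> b" "\<sigma> \<circ> c" "\<alpha> \<circ> \<sigma>" "\<beta> \<circ> \<sigma>" "\<gamma> \<circ> \<sigma>"
      using invol by (rule reflect)
    let ?H = "m.tadpole ?M ?M ?M"
    have start: "(\<sigma> \<circ> a) N = a N" using mirror[of N] by simp
    have ends: "(\<sigma> \<circ> a) 0 = a (2 * N)" "(\<sigma> \<circ> a) (2 * N) = a 0" using mirror by simp_all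
    have "?H \<in> unit_tadpoles" "(\<sigma> \<circ> a) N \<in> verts ?H"
      by (simp add: m.tadpole_in_unit_tadpoles) (simp add: m.tadpole_def)
    then obtain ys where ys: "produces Alg ?H ((\<sigma> \<circ> a) N) ys" "exploration_tour ?H ((\<sigma> \<circ> a) N) ys"
      using expl unfolding explores_def by blast
    \<comment> \<open>Such a vertex \<open>a i\<close> has depth \<open>2 * N - i\<close> in the
      mirrored star and the same two neighbours, with inner and outer exchanged.\<close>
    have obs: "observe ?G (xs ! k) = observe ?H (xs ! k)" if k: "k < t" for k
    proof -
      obtain i where i: "0 < i" "i < 2 * N" "xs ! k = a i"
        using in_arm_before[OF N walk hd _ t_min k] t(1) by auto
      have a_i: "a i = (\<sigma> \<circ> a) (2 * N - i)" using i mirror[of "2 * N - i"] by simp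
      have nbs: "(\<sigma> \<circ> a) (2 * N - i - 1) = a (Suc i)" "(\<sigma> \<circ> a) (Suc (2 * N - i)) = a (i - 1)"
        using i mirror[of "2 * N - i - 1"] mirror[of "Suc (2 * N - i)"] by (simp_all add: Suc_diff_Suc)
      have "{a i, w} \<in> star_edges \<longleftrightarrow> {a i, w} \<in> m.star_edges" for w
        using star_edge_arm[OF i(1), of w] m.star_edge_arm[of "2 * N - i" w] i(2) nbs a_i by auto
      moreover have "observe ?G (a i) = (a i, {(w, 1) | w. {a i, w} \<in> star_edges})"
        using i by (intro observe_tadpole) simp_all
      moreover have "observe ?H (a i) = (a i, {(w, 1) | w. {a i, w} \<in> m.star_edges})"
        unfolding a_i using i by (intro m.observe_tadpole) (simp_all only: m.depth)
      ultimately show ?thesis using i(3) by simp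
    qed
    have pre: "t < length ys \<and> take (Suc t) ys = take (Suc t) xs"
      by (rule produces_prefix[OF xs(1) _ t(1) obs]) (use ys(1) start in simp)
    then have eq: "ys ! k = xs ! k" if "k \<le> t" for k
      using that by (metis le_imp_less_Suc nth_take)
    \<comment> \<open>In the mirror image this vertex is the junction, reached before the other
      candidate, so the previous case applies there.\<close>
    have "ys ! t = (\<sigma> \<circ> a) 0" using eq[of t] at_t ends by simp
    moreover have "ys ! k \<notin> {(\<sigma> \<circ> a) 0, (\<sigma> \<circ> a) (2 * N)}" if "k < t" for k
      using eq[of k] t_min[OF that] that unfolding ends by auto
    ultimately show ?thesis
      using m.centre_first_beaten[OF expl N ys, of t] pre unfolding start by blast
  qed
qed

end

section \<open>Concrete labels and the choice of the distance\<close>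

theorem theorem1:
  fixes \<epsilon> :: real
  assumes "0 < \<epsilon>" and "\<epsilon> < 1"
  shows "(\<nexists>A. explores A unit_tadpoles \<and> competitive (2 - \<epsilon>) A unit_tadpoles) \<and>
         (\<forall>A. explores A unit_tadpoles \<longrightarrow>
            (\<exists>G\<in>unit_tadpoles. \<exists>s\<in>verts G. cost_alg A G s > (2 - \<epsilon>) * cost_opt G s))"
proof -
  have beaten: "\<exists>G\<in>unit_tadpoles. \<exists>s\<in>verts G. cost_alg Alg G s > (2 - \<epsilon>) * cost_opt G s"
    if expl: "explores Alg unit_tadpoles" for Alg
  proof -
    \<comment> \<open>This makes \<epsilon> times the optimum bound, which is at least
      \<open>N\<close>, exceed the additive loss 7.\<close>
    obtain N :: nat where N: "7 / \<epsilon> < real N" using reals_Archimedean2 by blast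
    then have N_pos: "0 < N" using assms by (cases N) (auto simp: divide_less_0_iff)
    \<comment> \<open>Residues modulo 4: the ray from the start \<open>0\<close> through the junction, the opposite ray, the two
      further arms; \<open>\<sigma>\<close> exchanges the two rays.\<close>
    define a where "a k = (if k \<le> N then 4 * (N - k) else 4 * (k - N) + 1)" for k
    define b where "b k = (if k = 0 then 4 * N else 4 * k + 2)" for k
    define c where "c k = (if k = 0 then 4 * N else 4 * k + 3)" for k
    define \<alpha> where "\<alpha> v = (if v mod 4 = 0 then N - v div 4 else if v mod 4 = 1 then N + v div 4 else 0)"
      for v :: nat
    define \<beta> where "\<beta> v = (if v mod 4 = 2 then v div 4 else 0)" for v :: nat
    define \<gamma> where "\<gamma> v = (if v mod 4 = 3 then v div 4 else 0)" for v :: nat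
    define \<sigma> where "\<sigma> v = (if v \<le> 1 then v else if v mod 4 = 0 then v + 1
      else if v mod 4 = 1 then v - 1 else v)" for v :: nat
    interpret star a b c \<alpha> \<beta> \<gamma>
    proof
      fix k
      have "Suc (Suc (4 * k)) mod 4 = 2" "Suc (Suc (4 * k)) div 4 = k"
        using mod_mult_self2[of 2 4 k] div_mult_self2[of 4 2 k] by simp_all
      note [simp] = this
      show "b 0 = a 0" "c 0 = a 0" by (simp_all add: a_def b_def c_def)
      show "\<alpha> (a k) = k" "\<alpha> (b k) = 0" "\<alpha> (c k) = 0" "\<beta> (a k) = 0" "\<beta> (b k) = k" "\<beta> (c k) = 0"
        "\<gamma> (a k) = 0" "\<gamma> (b k) = 0" "\<gamma> (c k) = k"
        by (simp_all add: a_def b_def c_def \<alpha>_def \<beta>_def \<gamma>_def del: One_nat_def)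
    qed
    \<comment> \<open>The start has label 0 and is its own mirror image, so the labels 0 and 1 stay
      fixed; \<open>4 * j\<close> and \<open>4 * j + 1\<close> are exchanged only for positive
      \<open>j\<close>.\<close>
    have "\<sigma> (\<sigma> v) = v" for v
    proof -
      have "(v + 1) mod 4 = 1" if "v mod 4 = 0"
        using that by (simp add: mod_Suc)
      moreover have "(v - 1) mod 4 = 0 \<and> 1 < v - 1" if "v mod 4 = 1" "1 < v"
      proof -
        have "v = 4 * (v div 4) + 1" using that(1) by (metis mult_div_mod_eq)
        then obtain n where "v = 4 * n + 1" by blast
        then show ?thesis using that(2) by simp
      qed
      ultimately show ?thesis by (auto simp: \<sigma>_def simp del: One_nat_def)
    qed
    moreover have "\<sigma> (a m) = a (2 * N - m)" if "m \<le> 2 * N" for m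
    proof -
      consider "m < N" | "m = N" | "N < m" by linarith
      then show ?thesis
      proof cases
        case 1
        then have "a m = 4 * (N - m)" "a (2 * N - m) = 4 * (N - m) + 1" "0 < N - m"
          by (auto simp: a_def)
        then show ?thesis by (auto simp: \<sigma>_def)
      next
        case 2
        then show ?thesis by (simp add: a_def \<sigma>_def)
      next
        case 3
        then have "a m = 4 * (m - N) + 1" "a (2 * N - m) = 4 * (m - N)" "0 < m - N"
          using that by (auto simp: a_def)
        moreover have "(4 * (m - N) + 1) mod 4 = 1" by simp
        ultimately show ?thesis by (auto simp: \<sigma>_def simp del: One_nat_def)
      qed
    qed
    ultimately have "\<exists>G\<in>unit_tadpoles. \<exists>U. a N \<in> verts G \<and> N \<le> U \<and> cost_opt G (a N) \<le> real U \<and>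
        2 * real U - 7 \<le> cost_alg Alg G (a N)"
      by (rule adversary_beats[OF expl N_pos])
    then obtain G U where G: "G \<in> unit_tadpoles" "a N \<in> verts G" "N \<le> U"
      "cost_opt G (a N) \<le> real U" "2 * real U - 7 \<le> cost_alg Alg G (a N)"
      by blast
    have "(2 - \<epsilon>) * cost_opt G (a N) \<le> (2 - \<epsilon>) * real U"
      using G(4) assms by (intro mult_left_mono) auto
    moreover have "7 < \<epsilon> * real N" using N assms by (simp add: field_simps)
    moreover have "\<epsilon> * real N \<le> \<epsilon> * real U" using G(3) assms by simp
    ultimately have "(2 - \<epsilon>) * cost_opt G (a N) < cost_alg Alg G (a N)"
      using G(5) by (simp add: algebra_simps)
    then show ?thesis using G by blast
  qed
  show ?thesis
  proof (intro conjI allI impI notI)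
    assume "\<exists>A. explores A unit_tadpoles \<and> competitive (2 - \<epsilon>) A unit_tadpoles"
    then obtain A where "explores A unit_tadpoles" "competitive (2 - \<epsilon>) A unit_tadpoles" by blast
    then show False using beaten[of A] unfolding competitive_def by fastforce
  qed (rule beaten)
qed

end
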